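(* Let $K_1,\dots,K_n\in C^2_+$ be convex bodies in $\mathbb{R}^n$ and $\phi_1,\dots,\phi_n\in Conc(0,\infty)$. Then, for every integer $m$ with $1\le m\le n$, $$\big[as(\phi_1,K_1;\cdots;\phi_n,K_n)\big]^m\le\prod_{i=0}^{m-1}as(\phi_1,K_1;\cdots;\phi_{n-m},K_{n-m};\underbrace{\phi_{n-i},K_{n-i};\cdots;\phi_{n-i},K_{n-i}}_{m}).$$ Equality holds if (1) all $K_i$, $i=n-m+1,\dots,n$, coincide and $\phi_i=\lambda_i\phi_n$ for some $\lambda_i>0$, $i=n-m+1,\dots,n$; or (2) $\phi_i=\lambda_i\phi_n$ and $K_i=\eta_iK_n$ for some $\lambda_i,\eta_i>0$, $i=n-m+1,\dots,n$, and $\phi_n$ is homogeneous of degree $r\in[0,1)$. Equality holds trivially if $m=1$. In particular (for $m=n$), $$\big[as(\phi_1,K_1;\cdots;\phi_n,K_n)\big]^n\le as_{\phi_1}(K_1)\cdots as_{\phi_n}(K_n).$$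
   Context: Let $n\ge2$. $S^{n-1}$ is the unit sphere of $\mathbb{R}^n$ and $\sigma$ the usual surface area measure on it. $K\in C^2_+$ means that $K$ is a convex body in $\mathbb{R}^n$ with the origin in its interior and with $C^2$ boundary having everywhere strictly positive Gaussian curvature. $h_K(u)=\max_{x\in K}\langle x,u\rangle$ is the support function, and the curvature function $f_K(u)$, $u\in S^{n-1}$, is the reciprocal of the Gauss curvature of $\partial K$ at the point with outer unit normal $u$. $Conc(0,\infty)$ is the set of functions $\phi:(0,\infty)\to(0,\infty)$ such that either $\phi$ is a nonzero constant function, or $\phi$ is concave with $\lim_{t\to0}\phi(t)=0$ and $\lim_{t\to\infty}\phi(t)/t=0$. $\phi$ is homogeneous of degree $r$ if $\phi(\lambda t)=\lambda^r\phi(t)$ for all $\lambda,t>0$. The general mixed $L_\phi$-affine surface area, for $\phi_i\in Conc(0,\infty)$ and $K_i\in C^2_+$, is $$as(\phi_1,K_1;\cdots;\phi_n,K_n)=\int_{S^{n-1}}\prod_{i=1}^n\left[\phi_i\!\left(\frac{1}{f_{K_i}(u)h_{K_i}^{n+1}(u)}\right)h_{K_i}(u)f_{K_i}(u)\right]^{\frac1n}d\sigma(u),$$ and $as_\phi(K)=as(\phi,K;\cdots;\phi,K)$. *)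

theory Defs
  imports "HOL-Analysis.Analysis"
begin

text \<open>Surface area measure on the unit sphere in polar-coordinate form: a Borel set \<open>A\<close> of the sphere
  receives \<open>n\<close> times the Lebesgue measure of the cone \<open>{t *\<^sub>R u | t u. 0 < t \<and> t \<le> 1 \<and> u \<in> A}\<close>;
  note that \<open>sgn x = x /\<^sub>R norm x\<close>.\<close>

definition sphere_measure :: "(real^'n) measure" where
  "sphere_measure =
     scale_measure (of_nat CARD('n))
       (distr (restrict_space lborel (cball 0 1 - {0})) (restrict_space borel (sphere 0 1)) sgn)"

definition support_function :: "(real^'n) set \<Rightarrow> real^'n \<Rightarrow> real" where
  "support_function K u = (SUP x\<in>K. x \<bullet> u)"

definition outer_unit_normal :: "(real^'n) set \<Rightarrow> real^'n \<Rightarrow> real^'n \<Rightarrow> bool" where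
  "outer_unit_normal K x u \<longleftrightarrow> norm u = 1 \<and> x \<in> frontier K \<and> (\<forall>y\<in>K. y \<bullet> u \<le> x \<bullet> u)"

definition gauss_map :: "(real^'n) set \<Rightarrow> real^'n \<Rightarrow> real^'n" where
  "gauss_map K x = (THE u. outer_unit_normal K x u)"

text \<open>The Gauss curvature at \<open>x\<close> is the determinant of the Weingarten map, i.e. of the differential \<open>D\<close>
  of the Gauss map on the tangent space \<open>u\<^sup>\<bottom>\<close>, where \<open>u\<close> is the normal at \<open>x\<close>. The derivative within the
  boundary is determined only on \<open>u\<^sup>\<bottom>\<close> (which \<open>D\<close> maps to itself), so \<open>D\<close> is precomposed with the
  orthogonal projection onto \<open>u\<^sup>\<bottom>\<close> and extended by the identity on the line spanned by \<open>u\<close>; this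
  leaves the determinant unchanged.\<close>

definition gauss_curvature :: "(real^'n) set \<Rightarrow> real^'n \<Rightarrow> real" where
  "gauss_curvature K x =
     (let u = gauss_map K x; D = frechet_derivative (gauss_map K) (at x within frontier K)
      in det (matrix (\<lambda>v. D (v - (v \<bullet> u) *\<^sub>R u) + (v \<bullet> u) *\<^sub>R u)))"

definition C2_on :: "(real^'n) set \<Rightarrow> (real^'n \<Rightarrow> real) \<Rightarrow> bool" where
  "C2_on U F \<longleftrightarrow> (\<exists>(G :: real^'n \<Rightarrow> real^'n) (H :: real^'n \<Rightarrow> real^'n^'n).
     (\<forall>x\<in>U. (F has_derivative (\<lambda>v. G x \<bullet> v)) (at x) \<and> (G has_derivative (\<lambda>v. H x *v v)) (at x)) \<and>
     continuous_on U H)"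

text \<open>Locally \<open>K\<close> is a sublevel set of a \<open>C\<^sup>2\<close> function without critical points.\<close>

definition C2_boundary :: "(real^'n) set \<Rightarrow> bool" where
  "C2_boundary K \<longleftrightarrow> (\<forall>x\<in>frontier K. \<exists>U F. open U \<and> x \<in> U \<and> C2_on U F \<and>
     (\<forall>y\<in>U. \<not> (F has_derivative (\<lambda>_. 0)) (at y)) \<and> F x = 0 \<and>
     K \<inter> U = {y \<in> U. F y \<le> 0})"

definition C2_plus :: "(real^'n) set \<Rightarrow> bool" where
  "C2_plus K \<longleftrightarrow> compact K \<and> convex K \<and> 0 \<in> interior K \<and> C2_boundary K \<and>
     (\<forall>x\<in>frontier K. gauss_curvature K x > 0)"

definition curvature_function :: "(real^'n) set \<Rightarrow> real^'n \<Rightarrow> real" where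
  "curvature_function K u = 1 / gauss_curvature K (THE x. outer_unit_normal K x u)"

text \<open>Functions on \<open>(0,\<infinity>)\<close> are total functions on the reals whose values outside \<open>(0,\<infinity>)\<close> are ignored.\<close>

definition Conc :: "(real \<Rightarrow> real) \<Rightarrow> bool" where
  "Conc \<phi> \<longleftrightarrow> (\<forall>t>0. \<phi> t > 0) \<and>
     ((\<exists>c. c \<noteq> 0 \<and> (\<forall>t>0. \<phi> t = c)) \<or>
      (concave_on {0<..} \<phi> \<and> (\<phi> \<longlongrightarrow> 0) (at_right 0) \<and> ((\<lambda>t. \<phi> t / t) \<longlongrightarrow> 0) at_top))"

definition homogeneous :: "real \<Rightarrow> (real \<Rightarrow> real) \<Rightarrow> bool" where
  "homogeneous r \<phi> \<longleftrightarrow> (\<forall>l>0. \<forall>t>0. \<phi> (l * t) = l powr r * \<phi> t)"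

text \<open>The families are indexed by \<open>{1..n}\<close>, where \<open>n = CARD('n)\<close> is the dimension.\<close>

definition mixed_affine_area :: "(nat \<Rightarrow> real \<Rightarrow> real) \<Rightarrow> (nat \<Rightarrow> (real^'n) set) \<Rightarrow> real" where
  "mixed_affine_area \<phi> K =
     (\<integral>u. (\<Prod>i\<in>{1..CARD('n)}.
             (\<phi> i (1 / (curvature_function (K i) u * support_function (K i) u ^ (CARD('n) + 1)))
              * support_function (K i) u * curvature_function (K i) u) powr (1 / real CARD('n)))
      \<partial>sphere_measure)"

definition affine_area :: "(real \<Rightarrow> real) \<Rightarrow> (real^'n) set \<Rightarrow> real" where
  "affine_area \<phi> K = mixed_affine_area (\<lambda>_. \<phi>) (\<lambda>_. K)"

text \<open>Keeps the entries \<open>1, \<dots>, n - m\<close> of a family and puts its entry \<open>k\<close> into the last \<open>m\<close> places.\<close>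

definition repeat_last :: "nat \<Rightarrow> nat \<Rightarrow> nat \<Rightarrow> (nat \<Rightarrow> 'a) \<Rightarrow> nat \<Rightarrow> 'a" where
  "repeat_last n m k X = (\<lambda>j. if j \<le> n - m then X j else X k)"

end

theory Submission
  imports Defs
begin

text \<open>Writing \<open>g\<^sub>j\<close> for the \<open>j\<close>-th factor of the integrand, the inequality is Hoelder's inequality with \<open>m\<close> equal
  exponents (AM-GM after normalising the integrals) for the functions
  \<open>g\<^sub>1 \<cdots> g\<^bsub>n-m\<^esub> g\<^sub>k\<^sup>m\<close>, \<open>n - m < k \<le> n\<close>, and it is an equality as soon as the last \<open>m\<close> factors are proportional.
  The Bochner integral of a non-integrable function is \<open>0\<close>, so the integrals on the right-hand side must be
  shown to exist. This follows from continuity of the integrands: near a boundary point the Gauss map is the normalised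
  gradient of a defining function, positive curvature excludes segments in the boundary, hence the Gauss map is a
  homeomorphism onto the sphere, and both support function and curvature function are continuous and positive.\<close>

subsection \<open>Normals and the Gauss map\<close>

text \<open>With nonempty interior, frontier points are relative boundary points, where a supporting
  hyperplane exists. Its normal \<open>a\<close> points into the body, hence the sign in
  \<open>- sgn a\<close>.\<close>

lemma outer_unit_normal_exists:
  assumes "closed K" "convex K" "interior K \<noteq> {}" "x \<in> frontier K"
  obtains u where "outer_unit_normal K x u"
proof -
  have "x \<in> K" "x \<notin> rel_interior K"
    using assms by (auto simp: frontier_def rel_interior_nonempty_interior)
  then obtain a where a: "a \<noteq> 0" "\<And>y. y \<in> K \<Longrightarrow> a \<bullet> x \<le> a \<bullet> y"
    using supporting_hyperplane_rel_boundary[OF \<open>convex K\<close>] by metis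
  have "y \<bullet> - sgn a \<le> x \<bullet> - sgn a" if "y \<in> K" for y
    using a(2)[OF that] by (simp add: sgn_div_norm inner_commute mult_left_mono)
  then have "outer_unit_normal K x (- sgn a)"
    using a(1) assms(4) by (simp add: outer_unit_normal_def norm_sgn)
  then show ?thesis ..
qed

text \<open>The interior of the body lies in the interior of the supporting half-space, which is
  open, so the inequality is strict. This gives positivity of the support function and keeps tangent
  lines out of the interior.\<close>

lemma outer_unit_normal_interior_less:
  assumes "outer_unit_normal K x u" "p \<in> interior K"
  shows "p \<bullet> u < x \<bullet> u"
proof -
  have u: "u \<noteq> 0" "K \<subseteq> {y. u \<bullet> y \<le> x \<bullet> u}"
    using assms(1) by (auto simp: outer_unit_normal_def inner_commute)
  from interior_mono[OF u(2)] assms(2) interior_halfspace_le[OF u(1)] show ?thesis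
    by (auto simp: inner_commute)
qed

section \<open>Boundary points of local sublevel sets\<close>

text \<open>The derivative of \<open>F\<close> along \<open>d\<close> is negative, so
  \<open>F\<close> drops below 0 just after the start, while short steps stay in the open set
  \<open>U\<close>.\<close>

lemma sublevel_descent:
  fixes F :: "real^'n \<Rightarrow> real"
  assumes F: "(F has_derivative (\<lambda>v. g \<bullet> v)) (at y)" and "F y = 0"
    and U: "open U" "y \<in> U" "K \<inter> U = {z \<in> U. F z \<le> 0}" and "g \<bullet> d < 0"
  shows "\<exists>e>0. \<forall>t. 0 < t \<and> t < e \<longrightarrow> y + t *\<^sub>R d \<in> K"
proof -
  have "((\<lambda>t. F (y + t *\<^sub>R d)) has_derivative (\<lambda>t. g \<bullet> (t *\<^sub>R d))) (at 0)"
    by (rule has_derivative_compose[of "\<lambda>t. y + t *\<^sub>R d" "\<lambda>t. t *\<^sub>R d"])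
       (auto intro!: derivative_eq_intros F)
  then have "((\<lambda>t. F (y + t *\<^sub>R d)) has_real_derivative (g \<bullet> d)) (at 0)"
    by (simp add: has_field_derivative_def mult_commute_abs)
  from DERIV_neg_dec_right[OF this \<open>g \<bullet> d < 0\<close>]
  obtain e1 where e1: "e1 > 0" "\<And>t. 0 < t \<Longrightarrow> t < e1 \<Longrightarrow> F (y + t *\<^sub>R d) < 0"
    using \<open>F y = 0\<close> by auto
  have "((\<lambda>t. y + t *\<^sub>R d) \<longlongrightarrow> y + 0 *\<^sub>R d) (at_right 0)"
    by (intro tendsto_intros)
  then have "\<forall>\<^sub>F t in at_right (0::real). y + t *\<^sub>R d \<in> U"
    using U by (auto dest: topological_tendstoD)
  then obtain e2 where e2: "e2 > 0" "\<And>t. 0 < t \<Longrightarrow> t < e2 \<Longrightarrow> y + t *\<^sub>R d \<in> U"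
    by (auto simp: eventually_at_right_field)
  show ?thesis
    using e1 e2 U(3) by (intro exI[of _ "min e1 e2"]) (auto intro: less_imp_le)
qed

text \<open>Every strict descent direction of \<open>F\<close> leads into \<open>K\<close>, so its
  inner product with a normal is nonpositive. Only the direction of the gradient satisfies this for
  a whole half-space of directions.\<close>

lemma sublevel_normal_eq:
  fixes F :: "real^'n \<Rightarrow> real"
  assumes w: "outer_unit_normal K y w" and F: "(F has_derivative (\<lambda>v. g \<bullet> v)) (at y)" "F y = 0"
    and U: "open U" "y \<in> U" "K \<inter> U = {z \<in> U. F z \<le> 0}" and "g \<noteq> 0"
  shows "w = sgn g"
proof -
  have descent: "d \<bullet> w \<le> 0" if neg: "g \<bullet> d < 0" for d
  proof -
    obtain e where e: "e > 0" "\<And>t. 0 < t \<Longrightarrow> t < e \<Longrightarrow> y + t *\<^sub>R d \<in> K"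
      using sublevel_descent[OF F(1,2) U neg] by blast
    then have "y + (e/2) *\<^sub>R d \<in> K" by auto
    then have "(y + (e/2) *\<^sub>R d) \<bullet> w \<le> y \<bullet> w"
      using w by (auto simp: outer_unit_normal_def)
    then show ?thesis
      using \<open>e > 0\<close> by (auto simp: inner_add_left mult_le_0_iff)
  qed
  define u where "u = sgn g"
  have u: "norm u = 1" "u \<bullet> u = 1" and g: "g = norm g *\<^sub>R u"
    using \<open>g \<noteq> 0\<close> by (simp_all add: u_def norm_sgn dot_square_norm) (simp add: sgn_div_norm)
  have ng: "norm g > 0" using \<open>g \<noteq> 0\<close> by simp
  \<comment> \<open>The part of \<open>w\<close> orthogonal to the gradient; the aim is
    \<open>p = 0\<close>.\<close>
  define p where "p = w - (w \<bullet> u) *\<^sub>R u"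
  have pu: "p \<bullet> u = 0" by (simp add: p_def inner_diff_left u)
  have pw: "p \<bullet> w = p \<bullet> p"
    using pu by (simp add: p_def inner_diff_right inner_commute)
  \<comment> \<open>Tilting \<open>p\<close> by \<open>- e *\<^sub>R u\<close> makes it a strict
    descent direction; letting \<open>e\<close> tend to 0 then forces
    \<open>p \<bullet> p \<le> 0\<close>.\<close>
  have "p \<bullet> p \<le> e * (w \<bullet> u)" if "e > 0" for e
  proof -
    have "g \<bullet> (p - e *\<^sub>R u) = - (norm g * e)"
      using pu u by (subst g) (simp add: inner_diff_right inner_commute)
    then have "(p - e *\<^sub>R u) \<bullet> w \<le> 0"
      using descent ng that by simp
    then show ?thesis by (simp add: inner_diff_left pw inner_commute[of u w])
  qed
  note le = this
  have "p \<bullet> p \<le> 0"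
  proof (rule field_le_epsilon)
    fix e :: real assume "e > 0"
    have "w \<bullet> u \<le> 1"
      using Cauchy_Schwarz_ineq2[of w u] u w by (auto simp: outer_unit_normal_def)
    then have "e * (w \<bullet> u) \<le> e" using \<open>e > 0\<close> by simp
    with le[OF \<open>e > 0\<close>] show "p \<bullet> p \<le> 0 + e" by linarith
  qed
  then have "p = 0" by (metis inner_gt_zero_iff not_le)
  then have wu: "w = (w \<bullet> u) *\<^sub>R u" by (simp add: p_def)
  have "norm w = 1" using w by (simp add: outer_unit_normal_def)
  then have "\<bar>w \<bullet> u\<bar> = 1" using u(1) by (metis mult.right_neutral norm_scaleR wu)
  \<comment> \<open>The choice \<open>e = 1\<close> decides the sign and excludes
    \<open>w = - u\<close>.\<close>
  moreover have "0 \<le> w \<bullet> u" using le[of 1] by (simp add: \<open>p = 0\<close>)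
  ultimately have "w \<bullet> u = 1" by simp
  with wu show ?thesis by (simp add: u_def)
qed

text \<open>A negative value would by continuity put a whole neighbourhood of \<open>y\<close> into
  \<open>K\<close>, making \<open>y\<close> an interior point.\<close>

lemma frontier_sublevel_zero:
  fixes F :: "real^'n \<Rightarrow> real"
  assumes "closed K" "y \<in> frontier K" "isCont F y" "open U" "y \<in> U" "K \<inter> U = {z \<in> U. F z \<le> 0}"
  shows "F y = 0"
proof (rule ccontr)
  assume "F y \<noteq> 0"
  moreover have "y \<in> K" "y \<notin> interior K"
    using assms(1,2) by (auto simp: frontier_def)
  ultimately have "F y < 0" using assms(5,6) by force
  then have "\<forall>\<^sub>F z in nhds y. F z < 0"
    using \<open>isCont F y\<close> unfolding isCont_def tendsto_at_iff_tendsto_nhds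
    by (rule order_tendstoD(2)[rotated])
  moreover have "\<forall>\<^sub>F z in nhds y. z \<in> U"
    using assms(4,5) by (rule eventually_nhds_in_open)
  ultimately have "\<forall>\<^sub>F z in nhds y. z \<in> K"
    by eventually_elim (use assms(6) in force)
  then have "y \<in> interior K"
    by (auto simp: eventually_nhds interior_def)
  with \<open>y \<notin> interior K\<close> show False ..
qed

text \<open>The differential of \<open>sgn \<circ> G\<close> at a point where \<open>G\<close> has value \<open>g\<close> and Jacobian \<open>H\<close>.\<close>

definition sgn_differential :: "real^'n \<Rightarrow> real^'n^'n \<Rightarrow> real^'n \<Rightarrow> real^'n" where
  "sgn_differential g H v = (H *v v - (sgn g \<bullet> (H *v v)) *\<^sub>R sgn g) /\<^sub>R norm g"

lemma has_derivative_sgn_comp: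
  fixes G :: "real^'n \<Rightarrow> real^'n"
  assumes "(G has_derivative (\<lambda>v. H *v v)) (at x)" "G x \<noteq> 0"
  shows "((\<lambda>y. sgn (G y)) has_derivative sgn_differential (G x) H) (at x)"
proof -
  have "((\<lambda>y. norm (G y)) has_derivative (\<lambda>v. (H *v v) \<bullet> sgn (G x))) (at x)"
    using has_derivative_compose[OF assms(1) has_derivative_norm[OF assms(2)]] by simp
  from Deriv.has_derivative_inverse[OF _ this] assms(2)
  have "((\<lambda>y. inverse (norm (G y))) has_derivative
      (\<lambda>v. - (inverse (norm (G x)) * ((H *v v) \<bullet> sgn (G x)) * inverse (norm (G x))))) (at x)"
    by simp
  from has_derivative_scaleR[OF this assms(1)] show ?thesis
    by (simp add: sgn_div_norm[abs_def] sgn_differential_def[abs_def] divide_inverse_commute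
      scaleR_diff_right inner_commute algebra_simps)
qed

text \<open>The point on the tangent line lies in the supporting hyperplane, hence outside the
  interior, while tilting the direction inwards by \<open>e\<close> reaches a point of
  \<open>K\<close>. The segment between the two has length \<open>e * t\<close> and meets the
  frontier.\<close>

lemma sublevel_tangent_approx:
  fixes F :: "real^'n \<Rightarrow> real"
  assumes "closed K" and u: "outer_unit_normal K x (sgn g)"
    and F: "(F has_derivative (\<lambda>v. g \<bullet> v)) (at x)" "F x = 0"
    and U: "open U" "x \<in> U" "K \<inter> U = {z \<in> U. F z \<le> 0}"
    and v: "v \<bullet> g = 0" and "e > 0"
  shows "\<exists>d>0. \<forall>t. 0 < t \<and> t < d \<longrightarrow> (\<exists>y\<in>frontier K. norm (y - (x + t *\<^sub>R v)) \<le> e * t)"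
proof -
  have "g \<noteq> 0" using u by (auto simp: outer_unit_normal_def)
  have vu: "v \<bullet> sgn g = 0" using v by (simp add: sgn_div_norm)
  have "g \<bullet> sgn g > 0"
    using \<open>g \<noteq> 0\<close> by (simp add: sgn_div_norm dot_square_norm)
  then have "g \<bullet> (v - e *\<^sub>R sgn g) < 0"
    using v \<open>e > 0\<close> by (simp add: inner_diff_right inner_commute)
  from sublevel_descent[OF F U this] obtain d where
    d: "d > 0" "\<And>t. 0 < t \<Longrightarrow> t < d \<Longrightarrow> x + t *\<^sub>R (v - e *\<^sub>R sgn g) \<in> K"
    by blast
  show ?thesis
  proof (intro exI[of _ d] conjI allI impI)
    fix t :: real assume t: "0 < t \<and> t < d"
    let ?a = "x + t *\<^sub>R v" and ?b = "x + t *\<^sub>R (v - e *\<^sub>R sgn g)"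
    have "?a \<notin> interior K"
      using outer_unit_normal_interior_less[OF u] vu by (force simp: inner_add_left)
    have "?b \<in> K" using d t by blast
    have "\<exists>z\<in>closed_segment ?a ?b. z \<in> frontier K"
    proof (cases "?a \<in> K")
      case True
      then have "?a \<in> frontier K"
        using \<open>?a \<notin> interior K\<close> by (auto simp: frontier_def intro: closure_subset[THEN subsetD])
      then show ?thesis by blast
    next
      case False
      then have "closed_segment ?a ?b \<inter> frontier K \<noteq> {}"
        using \<open>?b \<in> K\<close> by (intro connected_Int_frontier) (auto simp: convex_connected)
      then show ?thesis by blast
    qed
    then obtain z where z: "z \<in> closed_segment ?a ?b" "z \<in> frontier K" by blast
    have "norm (z - ?a) \<le> norm (?b - ?a)" using segment_bound1[OF z(1)] .
    also have "?b - ?a = - ((t * e) *\<^sub>R sgn g)" by (simp add: algebra_simps)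
    also have "norm \<dots> = e * t"
      using t \<open>e > 0\<close> \<open>g \<noteq> 0\<close> by (simp add: norm_sgn)
    finally show "\<exists>y\<in>frontier K. norm (y - ?a) \<le> e * t" using z(2) by blast
  qed (rule d)
qed

text \<open>A derivative within \<open>S\<close> is determined in the directions that \<open>S\<close> approximates to first order.\<close>

lemma has_derivative_unique_tangent:
  fixes f :: "'a::real_normed_vector \<Rightarrow> 'b::real_normed_vector"
  assumes D: "(f has_derivative D) (at x within S)" "(f has_derivative D') (at x within S)"
    and approx: "\<And>e. e > 0 \<Longrightarrow>
      \<exists>d>0. \<forall>t. 0 < t \<and> t < d \<longrightarrow> (\<exists>y\<in>S. norm (y - (x + t *\<^sub>R v)) \<le> e * t)"
  shows "D v = D' v"
proof -
  define E where "E = (\<lambda>v. D v - D' v)"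
  have "((\<lambda>y. f y - f y) has_derivative E) (at x within S)"
    unfolding E_def by (intro has_derivative_diff D)
  then have "((\<lambda>y. 0) has_derivative E) (at x within S)" by simp
  then have E: "bounded_linear E"
    and small: "\<And>e. e > 0 \<Longrightarrow> \<exists>d>0. \<forall>y\<in>S. norm (y - x) < d \<longrightarrow> norm (E (y - x)) \<le> e * norm (y - x)"
    by (simp_all add: has_derivative_within_alt)
  interpret E: bounded_linear E by (rule E)
  obtain B where B: "B > 0" "\<And>w. norm (E w) \<le> norm w * B" using E.pos_bounded by blast
  \<comment> \<open>\<open>norm v + 1\<close> comes from the first-order smallness at
    \<open>y - x\<close>, \<open>B\<close> from applying \<open>E\<close> to the approximation
    error.\<close>
  define C where "C = norm v + 1 + B"
  have "C > 0" using B(1) by (simp add: C_def add_pos_pos add_nonneg_pos)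
  have bound: "norm (E v) \<le> e * C" if e: "0 < e" "e \<le> 1" for e
  proof -
    obtain d1 where d1: "d1 > 0" "\<And>y. y \<in> S \<Longrightarrow> norm (y - x) < d1 \<Longrightarrow> norm (E (y - x)) \<le> e * norm (y - x)"
      using small[OF e(1)] by blast
    obtain d2 where d2: "d2 > 0" "\<And>t. 0 < t \<Longrightarrow> t < d2 \<Longrightarrow> \<exists>y\<in>S. norm (y - (x + t *\<^sub>R v)) \<le> e * t"
      using approx[OF e(1)] by blast
    \<comment> \<open>Small enough for an approximating point \<open>y\<close> to exist and for
      \<open>y\<close> to be within \<open>d1\<close> of \<open>x\<close>; the latter uses
      \<open>e \<le> 1\<close>.\<close>
    define t where "t = min (d2 / 2) ((d1 / 2) / (norm v + 1))"
    have pos: "norm v + 1 > 0" by (simp add: add_nonneg_pos)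
    have t: "0 < t" "t < d2" using d1(1) d2(1) pos by (auto simp: t_def)
    have "t \<le> (d1 / 2) / (norm v + 1)" by (simp add: t_def)
    then have "t * (norm v + 1) \<le> d1 / 2" using pos by (simp only: pos_le_divide_eq)
    then have tv: "t * (norm v + 1) < d1" using d1(1) by simp
    obtain y where y: "y \<in> S" "norm (y - (x + t *\<^sub>R v)) \<le> e * t" using d2(2)[OF t] by blast
    have "norm (y - x) \<le> norm (y - (x + t *\<^sub>R v)) + norm (t *\<^sub>R v)"
      using norm_triangle_ineq[of "y - (x + t *\<^sub>R v)" "t *\<^sub>R v"] by simp
    also have "\<dots> \<le> 1 * t + t * norm v"
      using y(2) mult_right_mono[OF e(2), of t] t(1)
      by (intro add_mono order.trans[OF y(2)]) auto
    finally have yx: "norm (y - x) \<le> t * (norm v + 1)" by (simp add: algebra_simps)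
    have "E (t *\<^sub>R v) = E (y - x) - E (y - (x + t *\<^sub>R v))"
      by (simp add: E.diff E.add)
    then have "norm (E (t *\<^sub>R v)) \<le> norm (E (y - x)) + norm (E (y - (x + t *\<^sub>R v)))"
      by (simp add: norm_triangle_ineq4)
    also have "\<dots> \<le> e * norm (y - x) + norm (y - (x + t *\<^sub>R v)) * B"
      using d1(2)[OF y(1)] yx tv B(2) by (intro add_mono) auto
    also have "\<dots> \<le> e * (t * (norm v + 1)) + (e * t) * B"
      using yx y(2) e(1) B(1) by (intro add_mono mult_left_mono mult_right_mono) auto
    finally have "t * norm (E v) \<le> t * (e * C)"
      using t(1) by (simp add: E.scaleR C_def algebra_simps)
    then show ?thesis using t(1) by simp
  qed
  have "norm (E v) \<le> 0"
  proof (rule field_le_epsilon)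
    fix e :: real assume "e > 0"
    then have "norm (E v) \<le> min 1 (e / C) * C" using \<open>C > 0\<close> by (intro bound) auto
    also have "\<dots> \<le> e / C * C" using \<open>C > 0\<close> by (intro mult_right_mono) auto
    also have "\<dots> = 0 + e" using \<open>C > 0\<close> by simp
    finally show "norm (E v) \<le> 0 + e" .
  qed
  then show ?thesis by (simp add: E_def)
qed

section \<open>Charts and differentiability of the Gauss map\<close>

text \<open>Of a local defining function only the gradient \<open>G\<close> and the Hessian
  \<open>H\<close> survive, with the two geometric facts used later: \<open>sgn (G y)\<close> is the
  only unit normal, and the frontier approximates tangent directions to first order.\<close>

locale C2_chart =
  fixes K U :: "(real^'n) set" and G :: "real^'n \<Rightarrow> real^'n" and H :: "real^'n \<Rightarrow> real^'n^'n"
  assumes open_chart: "open U"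
    and gradient_nonzero: "y \<in> U \<Longrightarrow> G y \<noteq> 0"
    and gradient_derivative: "y \<in> U \<Longrightarrow> (G has_derivative (\<lambda>v. H y *v v)) (at y)"
    and continuous_hessian: "continuous_on U H"
    and normal_iff: "y \<in> U \<Longrightarrow> y \<in> frontier K \<Longrightarrow> outer_unit_normal K y w \<longleftrightarrow> w = sgn (G y)"
    and tangent_approx: "y \<in> U \<Longrightarrow> y \<in> frontier K \<Longrightarrow> v \<bullet> G y = 0 \<Longrightarrow> e > 0 \<Longrightarrow>
      \<exists>d>0. \<forall>t. 0 < t \<and> t < d \<longrightarrow> (\<exists>z\<in>frontier K. norm (z - (y + t *\<^sub>R v)) \<le> e * t)"
begin

lemma gauss_map_eq_sgn:
  assumes "y \<in> U" "y \<in> frontier K"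
  shows "gauss_map K y = sgn (G y)"
  unfolding gauss_map_def normal_iff[OF assms] by simp

text \<open>On the frontier near \<open>y\<close> the Gauss map agrees with
  \<open>sgn \<circ> G\<close>, which is differentiable on an open set; agreement on the frontier is
  enough for the derivative within it.\<close>

lemma gauss_map_has_derivative:
  assumes "y \<in> U" "y \<in> frontier K"
  shows "(gauss_map K has_derivative sgn_differential (G y) (H y)) (at y within frontier K)"
proof -
  obtain r where r: "r > 0" "ball y r \<subseteq> U"
    using assms open_chart by (meson open_contains_ball)
  have "((\<lambda>z. sgn (G z)) has_derivative sgn_differential (G y) (H y)) (at y within frontier K)"
    using has_derivative_sgn_comp[OF gradient_derivative gradient_nonzero] assms
    by (blast intro: has_derivative_at_withinI)
  then show ?thesis
  proof (rule has_derivative_transform_within[OF _ r(1) assms(2)])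
    fix z assume z: "z \<in> frontier K" "dist z y < r"
    then have "z \<in> U" using r(2) by (auto simp: dist_commute)
    from gauss_map_eq_sgn[OF this z(1)] show "sgn (G z) = gauss_map K z" by simp
  qed
qed

text \<open>First-order approximation by frontier points fixes the derivative on the tangent space.
  This makes the curvature independent of which derivative \<open>frechet_derivative\<close>
  selects.\<close>

lemma gauss_map_derivative_unique:
  assumes x: "x \<in> U" "x \<in> frontier K"
    and D: "(gauss_map K has_derivative D) (at x within frontier K)"
      "(gauss_map K has_derivative D') (at x within frontier K)"
    and v: "v \<bullet> gauss_map K x = 0"
  shows "D v = D' v"
proof -
  have "v \<bullet> G x = 0"
    using v gradient_nonzero[OF x(1)] by (simp add: gauss_map_eq_sgn[OF x] sgn_div_norm)
  from has_derivative_unique_tangent[OF D tangent_approx[OF x this]] show ?thesis .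
qed

end

text \<open>Convexity supplies a normal at each frontier point, and the defining function leaves
  only \<open>sgn (G y)\<close> as a candidate; together these give
  \<open>normal_iff\<close>.\<close>

lemma C2_plus_chart:
  fixes K :: "(real^'n) set"
  assumes K: "C2_plus K" and x: "x \<in> frontier K"
  obtains U G H where "C2_chart K U G H" "x \<in> U"
proof -
  have cl: "closed K" and cv: "convex K" and ne: "interior K \<noteq> {}"
    using K by (auto simp: C2_plus_def compact_imp_closed)
  from K have "C2_boundary K" by (simp add: C2_plus_def)
  then have "\<exists>U F. open U \<and> x \<in> U \<and> C2_on U F \<and> (\<forall>y\<in>U. \<not> (F has_derivative (\<lambda>_. 0)) (at y)) \<and>
      F x = 0 \<and> K \<inter> U = {y \<in> U. F y \<le> 0}"
    using x unfolding C2_boundary_def by (elim bspec)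
  then obtain U F where U: "open U" "x \<in> U" "K \<inter> U = {z \<in> U. F z \<le> 0}" and "C2_on U F"
    and crit: "\<And>y. y \<in> U \<Longrightarrow> \<not> (F has_derivative (\<lambda>_. 0)) (at y)"
    by (elim exE conjE) blast
  then obtain G H where F: "\<And>y. y \<in> U \<Longrightarrow> (F has_derivative (\<lambda>v. G y \<bullet> v)) (at y)"
    and G: "\<And>y. y \<in> U \<Longrightarrow> (G has_derivative (\<lambda>v. H y *v v)) (at y)" and H: "continuous_on U H"
    unfolding C2_on_def by blast
  have G0: "G y \<noteq> 0" if "y \<in> U" for y
    using crit[OF that] F[OF that] by (metis inner_zero_left ext)
  have F0: "F y = 0" if "y \<in> U" "y \<in> frontier K" for y
    using frontier_sublevel_zero[OF cl that(2) has_derivative_continuous[OF F[OF that(1)]] U(1) that(1) U(3)] .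
  have normal: "outer_unit_normal K y w \<longleftrightarrow> w = sgn (G y)" if y: "y \<in> U" "y \<in> frontier K" for y w
  proof -
    have imp: "w = sgn (G y)" if "outer_unit_normal K y w" for w
      using sublevel_normal_eq[OF that F[OF y(1)] F0[OF y] U(1) y(1) U(3) G0[OF y(1)]] .
    moreover obtain w' where "outer_unit_normal K y w'"
      using outer_unit_normal_exists[OF cl cv ne y(2)] .
    ultimately show ?thesis by metis
  qed
  have "C2_chart K U G H"
  proof
    fix y v and e :: real assume "y \<in> U" "y \<in> frontier K" "v \<bullet> G y = 0" "e > 0"
    then show "\<exists>d>0. \<forall>t. 0 < t \<and> t < d \<longrightarrow> (\<exists>z\<in>frontier K. norm (z - (y + t *\<^sub>R v)) \<le> e * t)"
      using sublevel_tangent_approx[OF cl _ F F0 U(1) _ U(3)] normal by blast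
  qed (use U(1) G0 G H normal in auto)
  then show ?thesis using that U(2) by blast
qed

text \<open>Existence and uniqueness of the normal turn the definite description in
  \<open>gauss_map\<close> into an equivalence.\<close>

lemma outer_unit_normal_iff:
  assumes "C2_plus K"
  shows "outer_unit_normal K x u \<longleftrightarrow> x \<in> frontier K \<and> gauss_map K x = u"
proof (cases "x \<in> frontier K")
  case True
  from C2_plus_chart[OF assms True] obtain U G H where "C2_chart K U G H" "x \<in> U" .
  then show ?thesis
    using True C2_chart.normal_iff C2_chart.gauss_map_eq_sgn by metis
qed (simp add: outer_unit_normal_def)

lemma norm_gauss_map:
  assumes "C2_plus K" "x \<in> frontier K"
  shows "norm (gauss_map K x) = 1"
  using outer_unit_normal_iff[OF assms(1), of x "gauss_map K x"] assms(2)
  by (simp add: outer_unit_normal_def)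

lemma gauss_map_differentiable:
  assumes "C2_plus K" "x \<in> frontier K"
  shows "gauss_map K differentiable (at x within frontier K)"
proof -
  from C2_plus_chart[OF assms] obtain U G H where "C2_chart K U G H" "x \<in> U" .
  from C2_chart.gauss_map_has_derivative[OF this assms(2)] show ?thesis
    by (auto simp: differentiable_def)
qed

lemma gauss_map_derivative_unique:
  assumes "C2_plus K" "x \<in> frontier K"
    and "(gauss_map K has_derivative D) (at x within frontier K)"
      "(gauss_map K has_derivative D') (at x within frontier K)"
    and "v \<bullet> gauss_map K x = 0"
  shows "D v = D' v"
proof -
  from C2_plus_chart[OF assms(1,2)] obtain U G H where "C2_chart K U G H" "x \<in> U" .
  from C2_chart.gauss_map_derivative_unique[OF this assms(2-)] show ?thesis .
qed

section \<open>Gauss curvature and its continuity\<close>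

text \<open>The curvature is defined through a selected derivative, but only arguments orthogonal to
  \<open>u\<close> are fed into it, and there all derivatives agree. Explicit derivatives can
  therefore be inserted.\<close>

lemma gauss_curvature_eq:
  assumes K: "C2_plus K" and x: "x \<in> frontier K"
    and D: "(gauss_map K has_derivative D) (at x within frontier K)" and u: "u = gauss_map K x"
  shows "gauss_curvature K x = det (matrix (\<lambda>v. D (v - (v \<bullet> u) *\<^sub>R u) + (v \<bullet> u) *\<^sub>R u))"
proof -
  have D': "(gauss_map K has_derivative frechet_derivative (gauss_map K) (at x within frontier K)) (at x within frontier K)"
    using gauss_map_differentiable[OF K x] by (simp add: frechet_derivative_works)
  have "u \<bullet> u = 1" using norm_gauss_map[OF K x] u by (simp add: dot_square_norm)
  then have "(v - (v \<bullet> u) *\<^sub>R u) \<bullet> gauss_map K x = 0" for v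
    by (simp add: inner_diff_left u)
  from gauss_map_derivative_unique[OF K x D' D this] show ?thesis
    by (simp add: gauss_curvature_def Let_def u)
qed

lemma continuous_on_det:
  fixes A :: "'a::topological_space \<Rightarrow> real^'n^'n"
  assumes "continuous_on S A"
  shows "continuous_on S (\<lambda>x. det (A x))"
  unfolding det_def by (intro continuous_intros assms)

lemma continuous_on_matrix_vector_mult:
  fixes A :: "'a::topological_space \<Rightarrow> real^'n^'m" and v :: "'a \<Rightarrow> real^'n"
  assumes "continuous_on S A" "continuous_on S v"
  shows "continuous_on S (\<lambda>x. A x *v v x)"
  unfolding matrix_vector_mult_def by (intro continuous_intros assms)

context C2_chart
begin

lemma continuous_gradient: "continuous_on U G"
  using gradient_derivative has_derivative_continuous continuous_at_imp_continuous_on by blast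

text \<open>The chart differential is an explicit expression in \<open>G\<close> and
  \<open>H\<close>, both continuous with \<open>G\<close> nonzero, so all matrix entries and the
  determinant are continuous.\<close>

lemma continuous_on_gauss_curvature_chart:
  assumes K: "C2_plus K"
  shows "continuous_on (frontier K \<inter> U) (gauss_curvature K)"
proof -
  let ?S = "frontier K \<inter> U"
  let ?N = "\<lambda>y. sgn (G y)"
  let ?M = "\<lambda>y v. sgn_differential (G y) (H y) (v - (v \<bullet> ?N y) *\<^sub>R ?N y) + (v \<bullet> ?N y) *\<^sub>R ?N y"
  have G: "continuous_on ?S G" and H: "continuous_on ?S H"
    using continuous_gradient continuous_hessian continuous_on_subset by blast+
  have G0: "\<forall>y\<in>?S. G y \<noteq> 0" using gradient_nonzero by blast
  have N: "continuous_on ?S ?N" using G G0 by (intro continuous_intros)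
  have "continuous_on ?S (\<lambda>y. ?M y v)" for v
    unfolding sgn_differential_def
    using G0 by (intro continuous_intros continuous_on_matrix_vector_mult G H N) auto
  then have "continuous_on ?S (\<lambda>y. det (matrix (?M y)))"
    unfolding matrix_def
    by (intro continuous_on_det continuous_on_vec_lambda continuous_on_component)
  moreover have "gauss_curvature K y = det (matrix (?M y))" if "y \<in> ?S" for y
    using that gauss_map_has_derivative[of y] gauss_map_eq_sgn[of y]
    by (intro gauss_curvature_eq[OF K]) auto
  ultimately show ?thesis by (subst continuous_on_cong[OF refl]) auto
qed

end

lemma continuous_on_gauss_curvature:
  assumes K: "C2_plus K"
  shows "continuous_on (frontier K) (gauss_curvature K)"
  unfolding continuous_on_eq_continuous_within
proof
  fix x assume x: "x \<in> frontier K"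
  obtain U G H where "C2_chart K U G H" and xU: "x \<in> U" using C2_plus_chart[OF K x] .
  then interpret C2_chart K U G H by simp
  have "continuous (at x within frontier K \<inter> U) (gauss_curvature K)"
    using continuous_on_gauss_curvature_chart[OF K] x xU
    by (simp add: continuous_on_eq_continuous_within)
  moreover have "at x within frontier K = at x within frontier K \<inter> U"
    by (rule at_within_nhd[OF xU open_chart]) auto
  ultimately show "continuous (at x within frontier K) (gauss_curvature K)" by simp
qed

lemma continuous_on_gauss_map:
  assumes "C2_plus K"
  shows "continuous_on (frontier K) (gauss_map K)"
  using gauss_map_differentiable[OF assms] differentiable_imp_continuous_on
  unfolding differentiable_on_def by blast

section \<open>Bijectivity of the Gauss map\<close>

text \<open>A maximiser of a nonzero linear functional cannot be an interior point, so membership in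
  \<open>K\<close> already yields membership in the frontier.\<close>

lemma outer_unit_normalI:
  assumes "x \<in> K" "norm u = 1" "\<And>y. y \<in> K \<Longrightarrow> y \<bullet> u \<le> x \<bullet> u"
  shows "outer_unit_normal K x u"
proof -
  have u: "u \<noteq> 0" using assms(2) by auto
  have "K \<subseteq> {y. u \<bullet> y \<le> u \<bullet> x}" using assms(3) by (auto simp: inner_commute)
  from interior_mono[OF this] interior_halfspace_le[OF u] have "x \<notin> interior K" by auto
  then show ?thesis
    using assms closure_subset by (auto simp: outer_unit_normal_def frontier_def)
qed

text \<open>Otherwise the Gauss map is constant along a boundary segment, so its differential has a kernel and the
  curvature vanishes.\<close>

lemma inj_on_gauss_map:
  assumes K: "C2_plus K"
  shows "inj_on (gauss_map K) (frontier K)"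
proof (rule inj_onI, rule ccontr)
  fix x y assume x: "x \<in> frontier K" and y: "y \<in> frontier K"
    and eq: "gauss_map K x = gauss_map K y" and "x \<noteq> y"
  define u where "u = gauss_map K x"
  have cl: "closed K" and cv: "convex K" using K by (auto simp: C2_plus_def compact_imp_closed)
  have xK: "x \<in> K" and yK: "y \<in> K" using x y cl by (auto simp: frontier_def)
  have nx: "outer_unit_normal K x u" and ny: "outer_unit_normal K y u"
    using outer_unit_normal_iff[OF K] x y eq by (auto simp: u_def)
  have uu: "u \<bullet> u = 1" using nx by (simp add: outer_unit_normal_def dot_square_norm)
  define v where "v = y - x"
  \<comment> \<open>Both points maximise the inner product with \<open>u\<close>, so their
    difference is tangential.\<close>
  have vu: "v \<bullet> u = 0"
    using nx ny xK yK by (auto simp: outer_unit_normal_def v_def inner_diff_left intro: antisym)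
  define S where "S = (\<lambda>t. x + t *\<^sub>R v) ` {0..1}"
  have S: "outer_unit_normal K z u" if zS: "z \<in> S" for z
  proof -
    obtain t where t: "0 \<le> t" "t \<le> 1" "z = x + t *\<^sub>R v" using zS by (auto simp: S_def)
    have "z = (1 - t) *\<^sub>R x + t *\<^sub>R y" by (simp add: t v_def algebra_simps)
    then have "z \<in> K" using convexD_alt[OF cv xK yK t(1,2)] by simp
    moreover have "z \<bullet> u = x \<bullet> u" using vu by (simp add: t inner_add_left)
    ultimately show ?thesis using nx by (intro outer_unit_normalI) (auto simp: outer_unit_normal_def)
  qed
  have sub: "S \<subseteq> frontier K" and const: "\<And>z. z \<in> S \<Longrightarrow> gauss_map K z = u"
    using S outer_unit_normal_iff[OF K] by auto
  have xS: "x \<in> S" by (force simp: S_def)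
  obtain D where D: "(gauss_map K has_derivative D) (at x within frontier K)"
    using gauss_map_differentiable[OF K x] by (auto simp: differentiable_def)
  \<comment> \<open>The Gauss map is constant along the segment, so \<open>D\<close> and 0 are both
    derivatives within \<open>S\<close>; they agree on \<open>v\<close>, a direction in which
    \<open>S\<close> contains the exact points.\<close>
  have "((\<lambda>z. u) has_derivative D) (at x within S)"
    using has_derivative_transform[OF xS _ has_derivative_subset[OF D sub]] const by simp
  then have "D v = 0"
  proof (rule has_derivative_unique_tangent[OF _ has_derivative_const[of u]])
    fix e :: real assume "e > 0"
    show "\<exists>d>0. \<forall>t. 0 < t \<and> t < d \<longrightarrow> (\<exists>y\<in>S. norm (y - (x + t *\<^sub>R v)) \<le> e * t)"
    proof (intro exI[of _ 1] conjI allI impI)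
      fix t :: real assume "0 < t \<and> t < 1"
      then have "x + t *\<^sub>R v \<in> S" by (auto simp: S_def)
      then show "\<exists>y\<in>S. norm (y - (x + t *\<^sub>R v)) \<le> e * t"
        using \<open>e > 0\<close> \<open>0 < t \<and> t < 1\<close> by (intro bexI[of _ "x + t *\<^sub>R v"]) auto
    qed simp
  qed
  define M where "M = (\<lambda>v. D (v - (v \<bullet> u) *\<^sub>R u) + (v \<bullet> u) *\<^sub>R u)"
  interpret D: bounded_linear D using D by (rule has_derivative_bounded_linear)
  have "linear M"
    by (rule linearI) (simp_all add: M_def D.add D.diff D.scaleR inner_add_left algebra_simps)
  \<comment> \<open>The determinant of \<open>M\<close> is the curvature. As \<open>v\<close> is
    tangential, \<open>M v = D v = 0\<close> with \<open>v\<close> nonzero, so \<open>M\<close> is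
    singular.\<close>
  have "M v = M 0" by (simp add: M_def vu \<open>D v = 0\<close> D.zero)
  moreover have "v \<noteq> 0" using \<open>x \<noteq> y\<close> by (simp add: v_def)
  ultimately have "det (matrix M) = 0"
    using det_nz_iff_inj[OF \<open>linear M\<close>] by (metis injD)
  then have "gauss_curvature K x = 0"
    using gauss_curvature_eq[OF K x D u_def] by (simp add: M_def)
  then show False using K x by (auto simp: C2_plus_def)
qed

text \<open>Take a maximiser of the inner product with \<open>u\<close> on the compact body.\<close>

lemma outer_unit_normal_surj:
  assumes "compact K" "K \<noteq> {}" "norm u = 1"
  obtains x where "outer_unit_normal K x u"
proof -
  have "continuous_on K (\<lambda>y. y \<bullet> u)" by (intro continuous_intros)
  from continuous_attains_sup[OF assms(1,2) this]
  obtain x where "x \<in> K" "\<And>y. y \<in> K \<Longrightarrow> y \<bullet> u \<le> x \<bullet> u" by blast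
  with assms(3) have "outer_unit_normal K x u" by (intro outer_unit_normalI)
  then show ?thesis ..
qed

lemma ex1_outer_unit_normal:
  assumes K: "C2_plus K" and u: "norm u = 1"
  shows "\<exists>!x. outer_unit_normal K x u"
proof -
  have "compact K" "K \<noteq> {}" using K interior_subset by (auto simp: C2_plus_def)
  from outer_unit_normal_surj[OF this u] have "\<exists>x. outer_unit_normal K x u" by blast
  then show ?thesis
    using inj_on_gauss_map[OF K] by (auto simp: outer_unit_normal_iff[OF K] dest: inj_onD)
qed

text \<open>The boundary point occurring in \<open>curvature_function\<close>; its value is
  meaningful only for unit \<open>u\<close>.\<close>

definition inverse_gauss_map :: "(real^'n) set \<Rightarrow> real^'n \<Rightarrow> real^'n" where
  "inverse_gauss_map K u = (THE x. outer_unit_normal K x u)"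

lemma inverse_gauss_map_normal:
  assumes "C2_plus K" "norm u = 1"
  shows "outer_unit_normal K (inverse_gauss_map K u) u"
  unfolding inverse_gauss_map_def by (rule theI'[OF ex1_outer_unit_normal[OF assms]])

lemma inverse_gauss_map_eq:
  assumes "C2_plus K" "outer_unit_normal K x u"
  shows "inverse_gauss_map K u = x"
proof -
  have "norm u = 1" using assms(2) by (simp add: outer_unit_normal_def)
  from the1_equality[OF ex1_outer_unit_normal[OF assms(1) this] assms(2)] show ?thesis
    by (simp add: inverse_gauss_map_def)
qed

lemma inverse_gauss_map_frontier:
  assumes "C2_plus K" "norm u = 1"
  shows "inverse_gauss_map K u \<in> frontier K"
  using inverse_gauss_map_normal[OF assms] by (simp add: outer_unit_normal_def)

text \<open>The frontier is compact, so the inverse of the continuous injective Gauss map is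
  continuous on its image, which covers the sphere.\<close>

lemma continuous_on_inverse_gauss_map:
  fixes K :: "(real^'n) set"
  assumes K: "C2_plus K"
  shows "continuous_on (sphere 0 1) (inverse_gauss_map K)"
proof -
  have "compact (frontier K)" using K by (auto simp: C2_plus_def intro: compact_frontier)
  moreover have "\<forall>x\<in>frontier K. inverse_gauss_map K (gauss_map K x) = x"
    using inverse_gauss_map_eq[OF K] outer_unit_normal_iff[OF K] by blast
  ultimately have "continuous_on (gauss_map K ` frontier K) (inverse_gauss_map K)"
    using continuous_on_inv[OF continuous_on_gauss_map[OF K]] by blast
  moreover have "sphere 0 1 \<subseteq> gauss_map K ` frontier K"
  proof
    fix u :: "real^'n" assume "u \<in> sphere 0 1"
    then have "outer_unit_normal K (inverse_gauss_map K u) u"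
      using inverse_gauss_map_normal[OF K] by simp
    then show "u \<in> gauss_map K ` frontier K"
      by (metis outer_unit_normal_iff[OF K] imageI)
  qed
  ultimately show ?thesis by (rule continuous_on_subset)
qed

section \<open>Curvature function and support function on the sphere\<close>

lemma curvature_function_eq: "curvature_function K u = 1 / gauss_curvature K (inverse_gauss_map K u)"
  by (simp add: curvature_function_def inverse_gauss_map_def)

lemma curvature_function_pos:
  assumes "C2_plus K" "norm u = 1"
  shows "curvature_function K u > 0"
  using inverse_gauss_map_frontier[OF assms] assms(1)
  by (auto simp: curvature_function_eq C2_plus_def)

lemma continuous_on_curvature_function:
  assumes K: "C2_plus K"
  shows "continuous_on (sphere 0 1) (curvature_function K)"
proof -
  have sub: "inverse_gauss_map K ` sphere 0 1 \<subseteq> frontier K"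
    using inverse_gauss_map_frontier[OF K] by auto
  have "continuous_on (sphere 0 1) (\<lambda>u. gauss_curvature K (inverse_gauss_map K u))"
    by (rule continuous_on_compose2[OF continuous_on_gauss_curvature[OF K]
          continuous_on_inverse_gauss_map[OF K] sub])
  moreover have "gauss_curvature K (inverse_gauss_map K u) \<noteq> 0" if "u \<in> sphere 0 1" for u
    using that sub K by (force simp: C2_plus_def)
  ultimately show ?thesis
    unfolding curvature_function_eq by (intro continuous_intros) auto
qed

text \<open>The supremum is attained at the boundary point with normal \<open>u\<close>. This form
  inherits continuity from the inverse Gauss map and positivity from the origin being
  interior.\<close>

lemma support_function_eq:
  assumes K: "C2_plus K" and u: "norm u = 1"
  shows "support_function K u = inverse_gauss_map K u \<bullet> u"
proof -
  let ?x = "inverse_gauss_map K u"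
  have n: "outer_unit_normal K ?x u" by (rule inverse_gauss_map_normal[OF assms])
  then have "?x \<in> K"
    using K by (auto simp: outer_unit_normal_def C2_plus_def frontier_def compact_imp_closed)
  with n show ?thesis
    unfolding support_function_def by (intro cSup_eq_maximum) (auto simp: outer_unit_normal_def)
qed

lemma support_function_pos:
  assumes K: "C2_plus K" and u: "norm u = 1"
  shows "support_function K u > 0"
  using outer_unit_normal_interior_less[OF inverse_gauss_map_normal[OF assms], of 0] K
  by (simp add: support_function_eq[OF assms] C2_plus_def)

lemma continuous_on_support_function:
  assumes K: "C2_plus K"
  shows "continuous_on (sphere 0 1) (support_function K)"
proof -
  have "continuous_on (sphere 0 1) (\<lambda>u. inverse_gauss_map K u \<bullet> u)"
    by (intro continuous_intros continuous_on_inverse_gauss_map[OF K])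
  then show ?thesis
    by (subst continuous_on_cong[OF refl support_function_eq[OF K]]) auto
qed

subsection \<open>Dilations\<close>

text \<open>The map is the identity along \<open>u\<close> and multiplication by \<open>c\<close> on
  the orthogonal complement. An orthogonal map taking a coordinate vector to \<open>u\<close>
  conjugates it to a diagonal matrix with one entry 1 and all others \<open>c\<close>.\<close>

lemma det_scale_complement:
  fixes u :: "real^'n"
  assumes "norm u = 1"
  shows "det (matrix (\<lambda>v. c *\<^sub>R (v - (v \<bullet> u) *\<^sub>R u) + (v \<bullet> u) *\<^sub>R u)) = c ^ (CARD('n) - 1)"
proof -
  define S :: "real^'n \<Rightarrow> real^'n \<Rightarrow> real^'n"
    where "S = (\<lambda>w v. c *\<^sub>R (v - (v \<bullet> w) *\<^sub>R w) + (v \<bullet> w) *\<^sub>R w)"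
  define k where "k = (undefined :: 'n)"
  define e where "e = (axis k 1 :: real^'n)"
  have S: "linear (S w)" for w
    by (rule linearI) (simp_all add: S_def inner_add_left algebra_simps)
  have "norm e = 1" by (simp add: e_def norm_axis_1)
  then obtain R where R: "orthogonal_transformation R" "R e = u"
    using orthogonal_transformation_exists_1 assms by metis
  have lR: "linear R" using R(1) by (rule orthogonal_transformation_linear)
  have "S u (R v) = R (S e v)" for v
  proof -
    have "R v \<bullet> u = v \<bullet> e" using R by (metis orthogonal_transformation_def)
    then show ?thesis
      by (simp add: S_def linear_add[OF lR] linear_diff[OF lR] linear_cmul[OF lR] R(2))
  qed
  then have "S u \<circ> R = R \<circ> S e" by auto
  then have "det (matrix (S u)) * det (matrix R) = det (matrix R) * det (matrix (S e))"
    by (metis S lR matrix_compose det_mul)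
  moreover have "det (matrix R) \<noteq> 0"
    using det_nz_iff_inj[OF lR] orthogonal_transformation_inj[OF R(1)] by simp
  ultimately have "det (matrix (S u)) = det (matrix (S e))" by simp
  also have "\<dots> = (\<Prod>i\<in>UNIV. if i = k then 1 else c)"
  proof -
    have "axis j 1 \<bullet> e = (if j = k then 1 else 0)" for j
      by (simp add: e_def inner_axis_axis)
    then have "matrix (S e) $ i $ j = (if i = j then if i = k then 1 else c else 0)" for i j
      unfolding matrix_def S_def by (auto simp: e_def axis_def)
    then show ?thesis by (subst det_diagonal) auto
  qed
  also have "\<dots> = (\<Prod>i\<in>UNIV - {k}. c)"
    by (subst prod.remove[of _ k]) (auto intro!: prod.cong)
  also have "\<dots> = c ^ (CARD('n) - 1)" by simp
  finally show ?thesis by (simp add: S_def)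
qed

context
  fixes K L :: "(real^'n) set" and \<eta> :: real
  assumes K: "C2_plus K" and L: "C2_plus L" and \<eta>: "\<eta> > 0" and LK: "L = (\<lambda>x. \<eta> *\<^sub>R x) ` K"
begin

lemma outer_unit_normal_scaleR: "outer_unit_normal L (\<eta> *\<^sub>R x) u \<longleftrightarrow> outer_unit_normal K x u"
proof -
  \<comment> \<open>For a closed body the frontier condition can be replaced by membership, which
    passes through the dilation directly.\<close>
  have mem: "outer_unit_normal C z w \<longleftrightarrow> z \<in> C \<and> norm w = 1 \<and> (\<forall>y\<in>C. y \<bullet> w \<le> z \<bullet> w)"
    if "C2_plus C" for C z and w :: "real^'n"
  proof
    assume "outer_unit_normal C z w"
    then show "z \<in> C \<and> norm w = 1 \<and> (\<forall>y\<in>C. y \<bullet> w \<le> z \<bullet> w)"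
      using that by (auto simp: outer_unit_normal_def C2_plus_def frontier_def compact_imp_closed)
  qed (auto intro: outer_unit_normalI)
  show ?thesis
    unfolding mem[OF K] mem[OF L] using \<eta> by (auto simp: LK)
qed

lemma inverse_gauss_map_scaleR:
  assumes "norm u = 1"
  shows "inverse_gauss_map L u = \<eta> *\<^sub>R inverse_gauss_map K u"
  using inverse_gauss_map_eq[OF L] outer_unit_normal_scaleR inverse_gauss_map_normal[OF K assms] by blast

lemma support_function_scaleR:
  assumes "norm u = 1"
  shows "support_function L u = \<eta> * support_function K u"
  by (simp add: support_function_eq[OF K assms] support_function_eq[OF L assms]
      inverse_gauss_map_scaleR[OF assms])

lemma frontier_scaleR: "\<eta> *\<^sub>R x \<in> frontier L \<longleftrightarrow> x \<in> frontier K"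
  using outer_unit_normal_iff[OF K, of x] outer_unit_normal_iff[OF L, of "\<eta> *\<^sub>R x"]
  by (metis outer_unit_normal_scaleR)

lemma gauss_map_scaleR: "gauss_map L (\<eta> *\<^sub>R x) = gauss_map K x"
  by (simp add: gauss_map_def outer_unit_normal_scaleR)

text \<open>The Gauss map of \<open>L\<close> is that of \<open>K\<close> after division by
  \<open>\<eta>\<close>, so its differential is divided by \<open>\<eta>\<close> in each of the
  \<open>CARD('n) - 1\<close> tangent directions.\<close>

lemma gauss_curvature_scaleR:
  assumes x: "x \<in> frontier K"
  shows "gauss_curvature L (\<eta> *\<^sub>R x) = gauss_curvature K x / \<eta> ^ (CARD('n) - 1)"
proof -
  let ?f = "\<lambda>z. z /\<^sub>R \<eta>"
  define u where "u = gauss_map K x"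
  have nu: "norm u = 1" using norm_gauss_map[OF K x] by (simp add: u_def)
  then have uu: "u \<bullet> u = 1" by (simp add: dot_square_norm)
  have gL: "gauss_map L = (\<lambda>z. gauss_map K (?f z))"
    using gauss_map_scaleR[of "?f z" for z] \<eta> by (intro ext) simp
  have image: "?f ` frontier L \<subseteq> frontier K"
    using frontier_scaleR[of "?f z" for z] \<eta> by auto
  obtain D where D: "(gauss_map K has_derivative D) (at x within frontier K)"
    using gauss_map_differentiable[OF K x] by (auto simp: differentiable_def)
  then interpret D: bounded_linear D by (rule has_derivative_bounded_linear)
  have "(?f has_derivative ?f) (at (\<eta> *\<^sub>R x) within frontier L)"
    by (intro derivative_eq_intros) auto
  moreover have "(gauss_map K has_derivative D) (at (?f (\<eta> *\<^sub>R x)) within ?f ` frontier L)"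
    using has_derivative_subset[OF D image] \<eta> by simp
  ultimately have DL: "(gauss_map L has_derivative (\<lambda>v. D (?f v))) (at (\<eta> *\<^sub>R x) within frontier L)"
    unfolding gL by (rule has_derivative_in_compose)
  define M where "M = (\<lambda>v. D (v - (v \<bullet> u) *\<^sub>R u) + (v \<bullet> u) *\<^sub>R u)"
  define S where "S = (\<lambda>v. inverse \<eta> *\<^sub>R (v - (v \<bullet> u) *\<^sub>R u) + (v \<bullet> u) *\<^sub>R u)"
  have M: "linear M"
    by (rule linearI) (simp_all add: M_def D.add D.diff D.scaleR inner_add_left algebra_simps)
  have S: "linear S"
    by (rule linearI) (simp_all add: S_def inner_add_left algebra_simps)
  have Su: "S v \<bullet> u = v \<bullet> u" for v
    by (simp add: S_def inner_add_left inner_diff_left uu)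
  \<comment> \<open>\<open>S\<close> preserves the component along \<open>u\<close>, so the
    projection inside \<open>M\<close> isolates the scaled tangential part.\<close>
  have "(\<lambda>v. D (?f (v - (v \<bullet> u) *\<^sub>R u)) + (v \<bullet> u) *\<^sub>R u) = M \<circ> S"
    unfolding o_def M_def Su by (simp add: S_def)
  moreover have "u = gauss_map L (\<eta> *\<^sub>R x)" by (simp add: u_def gauss_map_scaleR)
  ultimately have "gauss_curvature L (\<eta> *\<^sub>R x) = det (matrix (M \<circ> S))"
    using gauss_curvature_eq[OF L _ DL, of u] x by (simp add: frontier_scaleR)
  also have "\<dots> = det (matrix M) * inverse \<eta> ^ (CARD('n) - 1)"
    using det_scale_complement[OF nu, of "inverse \<eta>"]
    unfolding matrix_compose[OF S M] det_mul by (simp add: S_def)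
  also have "det (matrix M) = gauss_curvature K x"
    using gauss_curvature_eq[OF K x D u_def] by (simp add: M_def)
  finally show ?thesis by (simp add: divide_inverse power_inverse)
qed

lemma curvature_function_scaleR:
  assumes "norm u = 1"
  shows "curvature_function L u = \<eta> ^ (CARD('n) - 1) * curvature_function K u"
  by (simp add: curvature_function_eq inverse_gauss_map_scaleR[OF assms]
      gauss_curvature_scaleR[OF inverse_gauss_map_frontier[OF K assms]])

end

subsection \<open>Integrals over the sphere\<close>

lemma space_sphere_measure: "space (sphere_measure :: (real^'n) measure) = sphere 0 1"
  by (simp add: sphere_measure_def space_scale_measure space_restrict_space)

text \<open>The total mass is \<open>CARD('n)\<close> times the volume of the punctured unit ball, a
  bounded set.\<close>

lemma finite_sphere_measure: "finite_measure (sphere_measure :: (real^'n) measure)"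
proof -
  let ?M = "restrict_space lborel (cball 0 1 - {0}) :: (real^'n) measure"
  let ?S = "restrict_space borel (sphere 0 1) :: (real^'n) measure"
  have "(\<lambda>x :: real^'n. sgn x) \<in> borel \<rightarrow>\<^sub>M borel"
    unfolding sgn_div_norm by measurable
  then have "sgn \<in> ?M \<rightarrow>\<^sub>M borel"
    by (intro measurable_restrict_space1) simp
  \<comment> \<open>\<open>sgn\<close> lands on the sphere because the origin has been
    removed.\<close>
  then have sgn: "sgn \<in> ?M \<rightarrow>\<^sub>M ?S"
    by (intro measurable_restrict_space2) (auto simp: norm_sgn space_restrict_space)
  have "emeasure (distr ?M ?S sgn) (space (distr ?M ?S sgn)) = emeasure ?M (space ?M)"
    using sgn measurable_space[OF sgn] sets.top[of ?S] by (subst emeasure_distr) (auto simp: space_restrict_space intro!: arg_cong[where f = "emeasure ?M"])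
  also have "\<dots> = emeasure lborel (cball 0 1 - {0 :: real^'n})"
    by (simp add: emeasure_restrict_space space_restrict_space)
  also have "\<dots> \<le> emeasure lborel (cball 0 1 :: (real^'n) set)"
    by (intro emeasure_mono) auto
  also have "\<dots> < \<infinity>"
    by (intro emeasure_bounded_finite) simp
  finally show ?thesis
    unfolding sphere_measure_def
    by (intro finite_measureI) (auto simp: space_scale_measure ennreal_mult_eq_top_iff)
qed

lemma integrable_continuous_on_sphere:
  fixes f :: "real^'n \<Rightarrow> real"
  assumes f: "continuous_on (sphere 0 1) f"
  shows "integrable sphere_measure f"
proof -
  interpret finite_measure "sphere_measure :: (real^'n) measure" by (rule finite_sphere_measure)
  have "compact (f ` sphere 0 1)"
    by (intro compact_continuous_image f) simp
  then have "bounded (f ` sphere 0 1)" by (rule compact_imp_bounded)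
  then obtain B where B: "\<And>u. u \<in> sphere 0 1 \<Longrightarrow> norm (f u) \<le> B"
    unfolding bounded_iff by blast
  have "sets sphere_measure = sets (restrict_space borel (sphere 0 1 :: (real^'n) set))"
    by (simp add: sphere_measure_def)
  then have "f \<in> borel_measurable sphere_measure"
    using borel_measurable_continuous_on_restrict[OF f] measurable_cong_sets by blast
  then show ?thesis
    using B by (intro integrable_const_bound[where B = B]) (auto simp: space_sphere_measure)
qed

section \<open>Hoelder's inequality for geometric means\<close>

text \<open>After dividing each function by its integral, the pointwise inequality of arithmetic and
  geometric means is integrated.\<close>

lemma integral_geometric_mean_le:
  fixes a :: "'i \<Rightarrow> 'a \<Rightarrow> real"
  assumes I: "finite I" "I \<noteq> {}" and nonneg: "\<And>i x. i \<in> I \<Longrightarrow> x \<in> space M \<Longrightarrow> 0 \<le> a i x"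
    and int: "\<And>i. i \<in> I \<Longrightarrow> integrable M (a i)"
  shows "(\<integral>x. (\<Prod>i\<in>I. a i x) powr (1 / card I) \<partial>M) ^ card I \<le> (\<Prod>i\<in>I. \<integral>x. a i x \<partial>M)"
proof -
  define A where "A = (\<lambda>i. \<integral>x. a i x \<partial>M)"
  let ?f = "\<lambda>x. (\<Prod>i\<in>I. a i x) powr (1 / card I)"
  have m: "card I > 0" using I by (simp add: card_gt_0_iff)
  have A: "0 \<le> A i" if "i \<in> I" for i
    unfolding A_def using nonneg[OF that] by (rule Bochner_Integration.integral_nonneg)
  then have PA: "0 \<le> (\<Prod>i\<in>I. A i)" by (rule prod_nonneg)
  \<comment> \<open>A nonintegrable geometric mean has default integral 0; a zero integral on the
    right makes the geometric mean vanish almost everywhere; otherwise all integrals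
    \<open>A i\<close> can be divided by.\<close>
  consider "\<not> integrable M ?f" | i where "i \<in> I" "A i = 0" | "integrable M ?f" "\<And>i. i \<in> I \<Longrightarrow> A i \<noteq> 0"
    by blast
  then have "(\<integral>x. ?f x \<partial>M) ^ card I \<le> (\<Prod>i\<in>I. A i)"
  proof cases
    case 1
    then show ?thesis using PA m by (simp add: not_integrable_integral_eq zero_power)
  next
    case (2 i)
    then have "AE x in M. a i x = 0"
      using integral_nonneg_eq_0_iff_AE[OF int[OF 2(1)]] nonneg[OF 2(1)] by (simp add: A_def)
    then have "AE x in M. ?f x = 0"
    proof eventually_elim
      case (elim x)
      then have "(\<Prod>i\<in>I. a i x) = 0" using I(1) 2(1) by auto
      then show ?case by simp
    qed
    then have "(\<integral>x. ?f x \<partial>M) = 0" by (rule integral_eq_zero_AE)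
    then show ?thesis using PA m by (simp add: zero_power)
  next
    case 3
    then have Apos: "\<And>i. i \<in> I \<Longrightarrow> A i > 0" using A by fastforce
    define P where "P = (\<Prod>i\<in>I. A i) powr (1 / card I)"
    have "(\<integral>x. ?f x \<partial>M) \<le> (\<integral>x. P * (\<Sum>i\<in>I. a i x / A i / card I) \<partial>M)"
    proof (rule integral_mono)
      fix x assume x: "x \<in> space M"
      have q: "\<And>i. i \<in> I \<Longrightarrow> 0 \<le> a i x / A i" using nonneg[OF _ x] A by simp
      have "(\<Prod>i\<in>I. a i x) = (\<Prod>i\<in>I. A i) * (\<Prod>i\<in>I. a i x / A i)"
        unfolding prod.distrib[symmetric] using Apos by (intro prod.cong) force+
      then have "?f x = P * (\<Prod>i\<in>I. a i x / A i) powr (1 / card I)"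
        using PA q by (simp add: P_def powr_mult prod_nonneg)
      also have "\<dots> \<le> P * (\<Sum>i\<in>I. a i x / A i / card I)"
        using arith_geom_mean[OF I q] by (intro mult_left_mono) (auto simp: P_def)
      finally show "?f x \<le> P * (\<Sum>i\<in>I. a i x / A i / card I)" .
    qed (use 3 int in auto)
    \<comment> \<open>Each normalised function integrates to 1, so their average does too and only
      \<open>P\<close> remains.\<close>
    also have "\<dots> = P * (\<Sum>i\<in>I. A i / A i / card I)"
      using int by (simp add: A_def del: divide_self_if)
    also have "(\<Sum>i\<in>I. A i / A i / card I) = (\<Sum>i\<in>I. 1 / card I)"
      using Apos by (intro sum.cong) force+
    also have "\<dots> = 1" using m by simp
    finally have "(\<integral>x. ?f x \<partial>M) ^ card I \<le> P ^ card I"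
      by (intro power_mono Bochner_Integration.integral_nonneg) auto
    also have "P ^ card I = (\<Prod>i\<in>I. A i)"
      using m prod_pos[of I A] Apos unfolding P_def by (simp add: powr_powr flip: powr_realpow)
    finally show ?thesis .
  qed
  then show ?thesis by (simp add: A_def)
qed

section \<open>Continuity and scaling of the factors of the integrand\<close>

lemma Conc_continuous:
  assumes "Conc \<phi>"
  shows "continuous_on {0<..} \<phi>"
proof -
  consider c where "\<forall>t>0. \<phi> t = c" | "concave_on {0<..} \<phi>"
    using assms unfolding Conc_def by blast
  then show ?thesis
  proof cases
    case 1
    then have "continuous_on {0<..} \<phi> \<longleftrightarrow> continuous_on {0<..} (\<lambda>t :: real. c)"
      by (intro continuous_on_cong) auto
    then show ?thesis by simp
  next
    case 2
    then have "continuous_on {0<..} (\<lambda>t. - (- \<phi> t))"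
      unfolding concave_on_def by (intro continuous_on_minus convex_on_continuous) auto
    then show ?thesis by simp
  qed
qed

text \<open>One factor of the integrand with the root already taken, so that a mixed area is the
  integral of a plain product.\<close>

definition affine_density :: "(real \<Rightarrow> real) \<Rightarrow> (real^'n) set \<Rightarrow> real^'n \<Rightarrow> real" where
  "affine_density \<phi> K u =
     (\<phi> (1 / (curvature_function K u * support_function K u ^ (CARD('n) + 1)))
       * support_function K u * curvature_function K u) powr (1 / real CARD('n))"

lemma mixed_affine_area_eq:
  "mixed_affine_area \<phi> K = (\<integral>u. (\<Prod>i\<in>{1..CARD('n)}. affine_density (\<phi> i) (K i) u) \<partial>sphere_measure)"
  for K :: "nat \<Rightarrow> (real^'n) set"
  by (simp add: mixed_affine_area_def affine_density_def)

lemma affine_density_pos: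
  assumes "C2_plus K" "Conc \<phi>" "norm u = 1"
  shows "affine_density \<phi> K u > 0"
proof -
  have "0 < curvature_function K u" "0 < support_function K u"
    using curvature_function_pos support_function_pos assms by blast+
  moreover from this have "0 < \<phi> (1 / (curvature_function K u * support_function K u ^ (CARD('a) + 1)))"
    using assms(2) by (auto simp: Conc_def)
  ultimately show ?thesis by (simp add: affine_density_def)
qed

lemma continuous_on_affine_density:
  fixes K :: "(real^'n) set"
  assumes K: "C2_plus K" and \<phi>: "Conc \<phi>"
  shows "continuous_on (sphere 0 1) (affine_density \<phi> K)"
proof -
  let ?f = "curvature_function K" and ?h = "support_function K"
  let ?t = "\<lambda>u. 1 / (?f u * ?h u ^ (CARD('n) + 1))"
  note cont = continuous_on_curvature_function[OF K] continuous_on_support_function[OF K]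
  have pos: "?f u > 0" "?h u > 0" if "u \<in> sphere 0 1" for u
    using that curvature_function_pos[OF K] support_function_pos[OF K] by auto
  have t: "continuous_on (sphere 0 1) ?t"
    using pos by (intro continuous_intros cont) force
  have tpos: "?t u > 0" if "u \<in> sphere 0 1" for u
    using pos[OF that] by simp
  have "continuous_on (sphere 0 1) (\<lambda>u. \<phi> (?t u))"
    using tpos by (intro continuous_on_compose2[OF Conc_continuous[OF \<phi>] t]) auto
  \<comment> \<open>A nonzero base gives continuity of \<open>powr\<close>.\<close>
  moreover have "\<phi> (?t u) * ?h u * ?f u \<noteq> 0" if "u \<in> sphere 0 1" for u
  proof -
    have "\<phi> (?t u) > 0" using \<phi> tpos[OF that] unfolding Conc_def by blast
    from mult_pos_pos[OF mult_pos_pos[OF this pos(2)[OF that]] pos(1)[OF that]] show ?thesis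
      by (rule less_imp_neq[symmetric])
  qed
  ultimately show ?thesis
    unfolding affine_density_def[abs_def] by (intro continuous_intros cont) blast+
qed

lemma affine_density_scalar:
  fixes K :: "(real^'n) set"
  assumes K: "C2_plus K" and u: "norm u = 1" and \<psi>: "\<forall>t>0. \<psi> t = l * \<phi> t" and "l > 0"
    and \<phi>: "Conc \<phi>"
  shows "affine_density \<psi> K u = l powr (1 / real CARD('n)) * affine_density \<phi> K u"
proof -
  have p: "0 < curvature_function K u" "0 < support_function K u"
    using curvature_function_pos[OF K u] support_function_pos[OF K u] .
  define t where "t = 1 / (curvature_function K u * support_function K u ^ (CARD('n) + 1))"
  have "t > 0" using p by (simp add: t_def)
  moreover from this have "\<phi> t > 0" using \<phi> by (simp add: Conc_def)
  ultimately show ?thesis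
    using p \<psi> \<open>l > 0\<close> unfolding affine_density_def t_def[symmetric]
    by (simp add: powr_mult mult.assoc)
qed

text \<open>Dilation multiplies \<open>h\<close> by \<open>\<eta>\<close> and \<open>f\<close> by
  \<open>\<eta> ^ (n - 1)\<close>, hence \<open>h * f\<close> by \<open>\<eta> ^ n\<close> and the
  argument of \<open>\<phi>\<close> by \<open>1 / \<eta> ^ (2 * n)\<close>. Homogeneity extracts the
  latter, leaving a factor independent of \<open>u\<close>.\<close>

lemma affine_density_scaleR:
  fixes K :: "(real^'n) set"
  assumes K: "C2_plus K" and L: "C2_plus L" and \<eta>: "\<eta> > 0" "L = (\<lambda>x. \<eta> *\<^sub>R x) ` K"
    and \<phi>: "Conc \<phi>" "homogeneous r \<phi>" and u: "norm u = 1"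
  defines "n \<equiv> CARD('n)"
  shows "affine_density \<phi> L u =
    ((1 / \<eta> ^ (2 * n)) powr r * \<eta> ^ n) powr (1 / real n) * affine_density \<phi> K u"
proof -
  let ?f = "curvature_function K u" and ?h = "support_function K u"
  have p: "0 < ?f" "0 < ?h"
    using curvature_function_pos[OF K u] support_function_pos[OF K u] .
  have "n > 0" by (simp add: n_def)
  \<comment> \<open>This replaces the truncated subtraction \<open>n - 1\<close> in exponents by
    \<open>k\<close>.\<close>
  then obtain k where k: "n = Suc k" using gr0_implies_Suc by blast
  define t where "t = 1 / (?f * ?h ^ (n + 1))"
  have t: "t > 0" using p by (simp add: t_def)
  then have \<phi>t: "\<phi> t > 0" using \<phi> by (simp add: Conc_def)
  have "\<eta> ^ (2 * n) = \<eta> ^ k * \<eta> ^ (n + 1)"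
    by (subst power_add[symmetric]) (simp add: k mult_2)
  then have "1 / (\<eta> ^ k * ?f * (\<eta> * ?h) ^ (n + 1)) = 1 / \<eta> ^ (2 * n) * t"
    by (simp only: t_def power_mult_distrib times_divide_times_eq mult.assoc mult.left_commute mult_1_left)
  then have arg: "\<phi> (1 / (\<eta> ^ k * ?f * (\<eta> * ?h) ^ (n + 1))) = (1 / \<eta> ^ (2 * n)) powr r * \<phi> t"
    using \<phi>(2)[unfolded homogeneous_def, rule_format, of "1 / \<eta> ^ (2 * n)" t] t \<eta>(1)
    by (simp only: zero_less_divide_1_iff zero_less_power)
  have "affine_density \<phi> L u =
      ((1 / \<eta> ^ (2 * n)) powr r * \<phi> t * (\<eta> * ?h) * (\<eta> ^ k * ?f)) powr (1 / real n)"
    unfolding affine_density_def n_def[symmetric] curvature_function_scaleR[OF K L \<eta> u]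
      support_function_scaleR[OF K L \<eta> u]
    using arg by (simp add: k)
  also have "(1 / \<eta> ^ (2 * n)) powr r * \<phi> t * (\<eta> * ?h) * (\<eta> ^ k * ?f) =
      ((1 / \<eta> ^ (2 * n)) powr r * \<eta> ^ n) * (\<phi> t * ?h * ?f)"
    by (simp add: k)
  also have "\<dots> powr (1 / real n) =
      ((1 / \<eta> ^ (2 * n)) powr r * \<eta> ^ n) powr (1 / real n) * (\<phi> t * ?h * ?f) powr (1 / real n)"
    by (rule powr_mult)
  finally show ?thesis by (simp add: affine_density_def n_def t_def)
qed

section \<open>Product inequality and its equality case\<close>

text \<open>Among the \<open>m\<close> integrands on the right, each of the first
  \<open>n - m\<close> factors occurs once in every one, and each of the last \<open>m\<close>
  factors occurs \<open>m\<close> times in its own. Their geometric mean is therefore the integrand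
  on the left.\<close>

lemma integral_prod_power_le:
  fixes G :: "nat \<Rightarrow> 'a \<Rightarrow> real"
  assumes m: "m \<in> {1..n}" and pos: "\<And>j x. j \<in> {1..n} \<Longrightarrow> x \<in> space M \<Longrightarrow> G j x > 0"
    and int: "\<And>k. k \<in> {n-m+1..n} \<Longrightarrow> integrable M (\<lambda>x. \<Prod>j\<in>{1..n}. if j \<le> n - m then G j x else G k x)"
  shows "(\<integral>x. (\<Prod>j\<in>{1..n}. G j x) \<partial>M) ^ m
    \<le> (\<Prod>k\<in>{n-m+1..n}. \<integral>x. (\<Prod>j\<in>{1..n}. if j \<le> n - m then G j x else G k x) \<partial>M)"
proof -
  let ?T = "{n-m+1..n}"
  let ?a = "\<lambda>k x. \<Prod>j\<in>{1..n}. if j \<le> n - m then G j x else G k x"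
  have cT: "card ?T = m" and T: "finite ?T" "?T \<noteq> {}" using m by auto
  have a0: "0 \<le> ?a k x" if "k \<in> ?T" "x \<in> space M" for k x
    using that by (intro prod_nonneg) (auto intro!: less_imp_le pos)
  have "(\<Prod>k\<in>?T. ?a k x) powr (1 / card ?T) = (\<Prod>j\<in>{1..n}. G j x)" if x: "x \<in> space M" for x
  proof -
    have P0: "0 < (\<Prod>j\<in>{1..n}. G j x)" using pos[OF _ x] by (intro prod_pos) auto
    have "(\<Prod>k\<in>?T. ?a k x) = (\<Prod>j\<in>{1..n}. \<Prod>k\<in>?T. if j \<le> n - m then G j x else G k x)"
      by (rule prod.swap)
    \<comment> \<open>For early \<open>j\<close> the inner factor is constant in \<open>k\<close>;
      for late \<open>j\<close> the inner product does not depend on \<open>j\<close>, which will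
      give its \<open>m\<close>th power.\<close>
    also have "\<dots> = (\<Prod>j\<in>{1..n}. if j \<le> n - m then G j x ^ m else (\<Prod>k\<in>?T. G k x))"
      using cT by (intro prod.cong) auto
    also have "{1..n} = {1..n-m} \<union> ?T" using m by auto
    also have "(\<Prod>j\<in>{1..n-m} \<union> ?T. if j \<le> n - m then G j x ^ m else (\<Prod>k\<in>?T. G k x)) =
        (\<Prod>j\<in>{1..n-m}. G j x ^ m) * (\<Prod>j\<in>?T. \<Prod>k\<in>?T. G k x)"
      by (subst prod.union_disjoint) (auto intro!: arg_cong2[where f = "(*)"] prod.cong)
    also have "\<dots> = ((\<Prod>j\<in>{1..n-m}. G j x) * (\<Prod>k\<in>?T. G k x)) ^ m"
      using cT by (simp add: prod_power_distrib power_mult_distrib)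
    also have "(\<Prod>j\<in>{1..n-m}. G j x) * (\<Prod>k\<in>?T. G k x) = (\<Prod>j\<in>{1..n-m} \<union> ?T. G j x)"
      by (subst prod.union_disjoint) auto
    also have "{1..n-m} \<union> ?T = {1..n}" using m by auto
    finally have "(\<Prod>k\<in>?T. ?a k x) = (\<Prod>j\<in>{1..n}. G j x) ^ m" .
    then show ?thesis
      using P0 m cT by (simp add: powr_realpow[symmetric] powr_powr)
  qed
  then have "(\<integral>x. (\<Prod>j\<in>{1..n}. G j x) \<partial>M) = (\<integral>x. (\<Prod>k\<in>?T. ?a k x) powr (1 / card ?T) \<partial>M)"
    by (intro Bochner_Integration.integral_cong) simp_all
  then show ?thesis
    using integral_geometric_mean_le[OF T a0 int] cT by simp
qed

text \<open>With the last \<open>m\<close> functions proportional to \<open>G n\<close>, all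
  integrands are constant multiples of one function \<open>W\<close>. Both sides become the
  \<open>m\<close>th power of the product of all \<open>c k\<close> times the integral of
  \<open>W\<close>.\<close>

lemma integral_prod_power_eq:
  fixes G :: "nat \<Rightarrow> 'a \<Rightarrow> real"
  assumes m: "m \<in> {1..n}"
    and ratio: "\<And>k x. k \<in> {n-m+1..n} \<Longrightarrow> x \<in> space M \<Longrightarrow> G k x = c k * G n x"
  shows "(\<integral>x. (\<Prod>j\<in>{1..n}. G j x) \<partial>M) ^ m
    = (\<Prod>k\<in>{n-m+1..n}. \<integral>x. (\<Prod>j\<in>{1..n}. if j \<le> n - m then G j x else G k x) \<partial>M)"
proof -
  let ?T = "{n-m+1..n}"
  define W where "W = (\<lambda>x. (\<Prod>j\<in>{1..n-m}. G j x) * G n x ^ m)"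
  have cT: "card ?T = m" using m by auto
  have split: "(\<Prod>j\<in>{1..n}. f j) = (\<Prod>j\<in>{1..n-m}. f j) * (\<Prod>j\<in>?T. f j)" for f :: "nat \<Rightarrow> real"
  proof -
    have "{1..n} = {1..n-m} \<union> ?T" using m by auto
    then show ?thesis by (simp add: prod.union_disjoint)
  qed
  have "(\<Prod>j\<in>{1..n}. G j x) = prod c ?T * W x" if x: "x \<in> space M" for x
  proof -
    have "(\<Prod>k\<in>?T. G k x) = (\<Prod>k\<in>?T. c k * G n x)" by (intro prod.cong refl ratio x)
    then show ?thesis unfolding split[of "\<lambda>j. G j x"] using cT by (simp add: W_def prod.distrib)
  qed
  then have L: "(\<integral>x. (\<Prod>j\<in>{1..n}. G j x) \<partial>M) = prod c ?T * integral\<^sup>L M W"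
    by (subst Bochner_Integration.integral_cong[OF refl]) (assumption, rule integral_mult_right_zero)
  have "(\<Prod>j\<in>{1..n}. if j \<le> n - m then G j x else G k x) = c k ^ m * W x"
    if k: "k \<in> ?T" and x: "x \<in> space M" for k x
  proof -
    have "(\<Prod>j\<in>{1..n}. if j \<le> n - m then G j x else G k x) = (\<Prod>j\<in>{1..n-m}. G j x) * (\<Prod>j\<in>?T. G k x)"
      by (subst split) (intro arg_cong2[where f = "(*)"] prod.cong; auto)
    also have "(\<Prod>j\<in>?T. G k x) = (c k * G n x) ^ m"
      using cT ratio[OF k x] by simp
    finally show ?thesis by (simp add: W_def power_mult_distrib)
  qed
  then have "(\<integral>x. (\<Prod>j\<in>{1..n}. if j \<le> n - m then G j x else G k x) \<partial>M) = c k ^ m * integral\<^sup>L M W"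
    if "k \<in> ?T" for k
    using that
    by (subst Bochner_Integration.integral_cong[OF refl]) (assumption, rule integral_mult_right_zero)
  then have "(\<Prod>k\<in>?T. \<integral>x. (\<Prod>j\<in>{1..n}. if j \<le> n - m then G j x else G k x) \<partial>M)
      = (\<Prod>k\<in>?T. c k ^ m * integral\<^sup>L M W)"
    by (intro prod.cong) auto
  \<comment> \<open>The range of \<open>k\<close> has \<open>m\<close> elements, so the integral of
    \<open>W\<close> occurs \<open>m\<close> times.\<close>
  also have "\<dots> = (prod c ?T * integral\<^sup>L M W) ^ m"
    using cT by (simp add: prod.distrib prod_power_distrib power_mult_distrib)
  finally show ?thesis using L by simp
qed

section \<open>Inequality and equality cases for mixed affine surface areas\<close>

theorem proposition3p1:
  fixes K :: "nat \<Rightarrow> (real^'n) set" and \<phi> :: "nat \<Rightarrow> real \<Rightarrow> real" and n :: nat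
  assumes "n = CARD('n)" and "n \<ge> 2"
    and "\<forall>i\<in>{1..n}. C2_plus (K i)"
    and "\<forall>i\<in>{1..n}. Conc (\<phi> i)"
  shows
    "(\<forall>m\<in>{1..n}.
        mixed_affine_area \<phi> K ^ m
          \<le> (\<Prod>i=0..m-1. mixed_affine_area (repeat_last n m (n - i) \<phi>) (repeat_last n m (n - i) K)) \<and>
        (((\<forall>i\<in>{n-m+1..n}. K i = K n \<and> (\<exists>l>0. \<forall>t>0. \<phi> i t = l * \<phi> n t)) \<or>
          (\<forall>i\<in>{n-m+1..n}. (\<exists>l>0. \<forall>t>0. \<phi> i t = l * \<phi> n t) \<and>
                            (\<exists>\<eta>>0. K i = (\<lambda>x. \<eta> *\<^sub>R x) ` K n)) \<and>
            (\<exists>r. 0 \<le> r \<and> r < 1 \<and> homogeneous r (\<phi> n)) \<or>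
          m = 1) \<longrightarrow>
         mixed_affine_area \<phi> K ^ m
           = (\<Prod>i=0..m-1. mixed_affine_area (repeat_last n m (n - i) \<phi>) (repeat_last n m (n - i) K)))) \<and>
     mixed_affine_area \<phi> K ^ n \<le> (\<Prod>i=1..n. affine_area (\<phi> i) (K i))"
proof -
  define G where "G = (\<lambda>j. affine_density (\<phi> j) (K j))"
  have C2: "C2_plus (K j)" and Co: "Conc (\<phi> j)" if "j \<in> {1..n}" for j
    using assms(3,4) that by blast+
  have n: "n \<in> {1..n}" using assms(2) by simp
  have pos: "G j u > 0" if "j \<in> {1..n}" "u \<in> space sphere_measure" for j u
    using that affine_density_pos[OF C2 Co] by (simp add: G_def space_sphere_measure)
  have area: "mixed_affine_area \<phi> K = (\<integral>u. (\<Prod>j\<in>{1..n}. G j u) \<partial>sphere_measure)"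
    unfolding mixed_affine_area_eq G_def assms(1) ..
  have rep: "mixed_affine_area (repeat_last n m k \<phi>) (repeat_last n m k K) =
      (\<integral>u. (\<Prod>j\<in>{1..n}. if j \<le> n - m then G j u else G k u) \<partial>sphere_measure)" for m k
    unfolding mixed_affine_area_eq G_def assms(1)[symmetric] repeat_last_def
    by (intro Bochner_Integration.integral_cong prod.cong) auto
  have int: "integrable sphere_measure (\<lambda>u. \<Prod>j\<in>{1..n}. if j \<le> n - m then G j u else G k u)"
    if "k \<in> {n-m+1..n}" for m k
  proof (intro integrable_continuous_on_sphere continuous_on_prod)
    fix j assume j: "j \<in> {1..n}"
    have "continuous_on (sphere 0 1) (G i)" if "i \<in> {1..n}" for i
      unfolding G_def by (rule continuous_on_affine_density[OF C2[OF that] Co[OF that]])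
    then show "continuous_on (sphere 0 1) (\<lambda>u. if j \<le> n - m then G j u else G k u)"
      using j that by (cases "j \<le> n - m") auto
  qed
  \<comment> \<open>The substitution \<open>k = n - i\<close> maps \<open>{0..m-1}\<close> onto the
    last \<open>m\<close> indices.\<close>
  have reindex: "(\<Prod>i=0..m-1. mixed_affine_area (repeat_last n m (n - i) \<phi>) (repeat_last n m (n - i) K)) =
      (\<Prod>k\<in>{n-m+1..n}. \<integral>u. (\<Prod>j\<in>{1..n}. if j \<le> n - m then G j u else G k u) \<partial>sphere_measure)"
    if m: "m \<in> {1..n}" for m
    unfolding rep using m
    by (intro prod.reindex_bij_witness[of _ "\<lambda>k. n - k" "\<lambda>i. n - i"]) auto
  have le: "mixed_affine_area \<phi> K ^ m
      \<le> (\<Prod>i=0..m-1. mixed_affine_area (repeat_last n m (n - i) \<phi>) (repeat_last n m (n - i) K))"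
    if m: "m \<in> {1..n}" for m
    unfolding reindex[OF m] area by (rule integral_prod_power_le[OF m pos int])
  \<comment> \<open>All equality cases reduce to the last \<open>m\<close> densities being
    proportional to \<open>G n\<close>, with constants independent of \<open>u\<close>.\<close>
  have eq: "mixed_affine_area \<phi> K ^ m
      = (\<Prod>i=0..m-1. mixed_affine_area (repeat_last n m (n - i) \<phi>) (repeat_last n m (n - i) K))"
    if m: "m \<in> {1..n}" and ratio: "\<forall>k\<in>{n-m+1..n}. \<exists>c. \<forall>u\<in>space sphere_measure. G k u = c * G n u" for m
  proof -
    from bchoice[OF ratio] obtain c where
      "\<And>k u. k \<in> {n-m+1..n} \<Longrightarrow> u \<in> space sphere_measure \<Longrightarrow> G k u = c k * G n u" by blast
    then show ?thesis
      unfolding reindex[OF m] area by (rule integral_prod_power_eq[OF m])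
  qed
  \<comment> \<open>First half of the comparison with \<open>G n\<close>: the function is exchanged
    while the body \<open>K k\<close> stays.\<close>
  have scalar: "\<exists>c. \<forall>u\<in>space sphere_measure. G k u = c * affine_density (\<phi> n) (K k) u"
    if k: "k \<in> {1..n}" and l: "\<exists>l>0. \<forall>t>0. \<phi> k t = l * \<phi> n t" for k
  proof -
    from l obtain l where l: "l > 0" "\<forall>t>0. \<phi> k t = l * \<phi> n t" by blast
    show ?thesis
      using affine_density_scalar[OF C2[OF k] _ l(2,1) Co[OF n]]
      by (intro exI[of _ "l powr (1 / real CARD('n))"]) (simp add: G_def space_sphere_measure)
  qed
  have case1: "\<forall>k\<in>{n-m+1..n}. \<exists>c. \<forall>u\<in>space sphere_measure. G k u = c * G n u"
    if m: "m \<in> {1..n}" and h: "\<forall>i\<in>{n-m+1..n}. K i = K n \<and> (\<exists>l>0. \<forall>t>0. \<phi> i t = l * \<phi> n t)" for m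
  proof
    fix k assume k: "k \<in> {n-m+1..n}"
    then have "k \<in> {1..n}" by simp
    moreover have "K k = K n" "\<exists>l>0. \<forall>t>0. \<phi> k t = l * \<phi> n t" using h k by blast+
    ultimately show "\<exists>c. \<forall>u\<in>space sphere_measure. G k u = c * G n u"
      using scalar[of k] by (simp add: G_def)
  qed
  have case2: "\<forall>k\<in>{n-m+1..n}. \<exists>c. \<forall>u\<in>space sphere_measure. G k u = c * G n u"
    if m: "m \<in> {1..n}" and h: "\<forall>i\<in>{n-m+1..n}. (\<exists>l>0. \<forall>t>0. \<phi> i t = l * \<phi> n t) \<and>
        (\<exists>\<eta>>0. K i = (\<lambda>x. \<eta> *\<^sub>R x) ` K n)" and r: "homogeneous r (\<phi> n)" for m r
  proof
    fix k assume k: "k \<in> {n-m+1..n}"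
    then have k1: "k \<in> {1..n}" by simp
    obtain c where c: "\<And>u. u \<in> space sphere_measure \<Longrightarrow> G k u = c * affine_density (\<phi> n) (K k) u"
      using scalar[OF k1] h k by blast
    obtain \<eta> where \<eta>: "\<eta> > 0" "K k = (\<lambda>x. \<eta> *\<^sub>R x) ` K n" using h k by blast
    \<comment> \<open>Second half: the body is exchanged by dilation, and the constants
      multiply.\<close>
    obtain d where d: "\<And>u. norm u = 1 \<Longrightarrow> affine_density (\<phi> n) (K k) u = d * G n u"
      unfolding G_def using affine_density_scaleR[OF C2[OF n] C2[OF k1] \<eta> Co[OF n] r] by blast
    have "\<forall>u\<in>space sphere_measure. G k u = (c * d) * G n u"
      using c d by (simp add: space_sphere_measure)
    then show "\<exists>c. \<forall>u\<in>space sphere_measure. G k u = c * G n u" ..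
  qed
  \<comment> \<open>For \<open>m = 1\<close> the range contains only \<open>k = n\<close>, with
    constant 1.\<close>
  have case3: "\<forall>k\<in>{n-1+1..n}. \<exists>c. \<forall>u\<in>space sphere_measure. G k u = c * G n u"
    using n by (auto intro: exI[of _ 1])
  \<comment> \<open>The case \<open>m = n\<close>: since \<open>j\<close> starts at 1,
    \<open>j \<le> n - n\<close> never holds and every place carries the entry
    \<open>k\<close>.\<close>
  have affine: "affine_area (\<phi> k) (K k) = (\<integral>u. (\<Prod>j\<in>{1..n}. if j \<le> n - n then G j u else G k u) \<partial>sphere_measure)" for k
    unfolding affine_area_def mixed_affine_area_eq G_def assms(1)[symmetric]
    by (intro Bochner_Integration.integral_cong prod.cong) auto
  have last: "mixed_affine_area \<phi> K ^ n \<le> (\<Prod>i=1..n. affine_area (\<phi> i) (K i))"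
    using le[OF n] unfolding reindex[OF n] affine by simp
  show ?thesis
  proof (intro conjI ballI impI le last)
    fix m assume m: "m \<in> {1..n}" and "(\<forall>i\<in>{n-m+1..n}. K i = K n \<and> (\<exists>l>0. \<forall>t>0. \<phi> i t = l * \<phi> n t)) \<or>
          (\<forall>i\<in>{n-m+1..n}. (\<exists>l>0. \<forall>t>0. \<phi> i t = l * \<phi> n t) \<and>
                            (\<exists>\<eta>>0. K i = (\<lambda>x. \<eta> *\<^sub>R x) ` K n)) \<and>
            (\<exists>r. 0 \<le> r \<and> r < 1 \<and> homogeneous r (\<phi> n)) \<or>
          m = 1"
    then show "mixed_affine_area \<phi> K ^ m
        = (\<Prod>i=0..m-1. mixed_affine_area (repeat_last n m (n - i) \<phi>) (repeat_last n m (n - i) K))"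
    proof (elim disjE conjE exE)
      assume "m = 1"
      with eq[of 1] case3 m show ?thesis by blast
    qed (rule eq[OF m], erule case1[OF m] case2[OF m], assumption?)+
  qed
qed

end
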